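(* Let $\Gamma=(\{1,2\},(C_1,C_2),(U_1,U_2))$ be a finite two-player game satisfying the following two conditions: (b) for all nonempty $B_1\subset C_1$ and $B_2\subset C_2$, every Nash equilibrium $\sigma$ of $\Gamma_{B_1\times B_2}$ is such that the supports of $\sigma_1$ and $\sigma_2$ have the same number of elements; (c) for any $i\in\{1,2\}$ and any $B_i\subset C_i$, $B_{-i}\subset C_{-i}$, $B'_{-i}\subset C_{-i}$ with $|B_i|=|B_{-i}|=|B'_{-i}|\ge 2$ and $B_{-i}\cap B'_{-i}=\emptyset$: if $\sigma$ and $\sigma'$ are completely mixed Nash equilibria of $\Gamma_{B_i\times B_{-i}}$ and $\Gamma_{B_i\times B'_{-i}}$ respectively, then $\sigma_i\ne\sigma'_i$. Then $\Gamma$ has a unique sequence of iterative full dual reductions.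
   Context: $C_1,C_2$ are finite nonempty, $C=C_1\times C_2$, utilities $U_i:C\to\mathbb{R}$ are extended multilinearly to mixed strategies, $-i$ denotes the opponent of $i$. For $B_i\subset C_i$ nonempty, $\Gamma_{B_1\times B_2}$ is the game obtained from $\Gamma$ by restricting the pure strategy set of each player $i$ to $B_i$. A Nash equilibrium is completely mixed if every pure strategy of each player has positive probability. For any finite game: a deviation plan for player $i$ is a map $\alpha_i:C_i\to\Delta(C_i)$; write $\alpha_i\ast c_i$ for the image of $c_i$, $\alpha_i(d_i|c_i)=(\alpha_i\ast c_i)(d_i)$, and $\alpha_i\ast\sigma_i=\sum_{c_i}\sigma_i(c_i)(\alpha_i\ast c_i)$ for $\sigma_i\in\Delta(C_i)$. A dual vector is a profile of deviation plans $\alpha=(\alpha_i)_i$ such that $\sum_{i}[U_i(c_{-i},\alpha_i\ast c_i)-U_i(c)]\ge 0$ for every $c\in C$. It is full if $\alpha_i(d_i|c_i)>0$ whenever $\beta_i(d_i|c_i)>0$ for some dual vector $\beta$. A nonempty $B_i\subset C_i$ is $\alpha_i$-absorbing if $\alpha_i\ast c_i$ has support in $B_i$ for every $c_i\in B_i$, and minimal $\alpha_i$-absorbing if moreover it has no nonempty proper absorbing subset. For each minimal $\alpha_i$-absorbing set there is a unique $\alpha_i$-stationary mixed strategy ($\alpha_i\ast\sigma_i=\sigma_i$) supported in it; $C_i/\alpha_i\subset\Delta(C_i)$ is the set of these strategies. $\Gamma/\alpha$ is the game with pure strategy sets $C_i/\alpha_i$ and the same utility functions; it is a full dual reduction of $\Gamma$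 if $\alpha$ is a full dual vector of $\Gamma$. A sequence of iterative full dual reductions of $\Gamma$ is a sequence of games $\Gamma^0=\Gamma,\Gamma^1,\Gamma^2,\dots$ in which each $\Gamma^{k+1}$ is a full dual reduction of $\Gamma^k$. *)

theory Defs
  imports "HOL-Probability.Probability"
begin

record ('a, 'b) game =
  strats1 :: "'a set"
  strats2 :: "'b set"
  util1 :: "'a \<Rightarrow> 'b \<Rightarrow> real"
  util2 :: "'a \<Rightarrow> 'b \<Rightarrow> real"

definition finite_game :: "('a, 'b) game \<Rightarrow> bool" where
  "finite_game G \<longleftrightarrow>
     finite (strats1 G) \<and> strats1 G \<noteq> {} \<and> finite (strats2 G) \<and> strats2 G \<noteq> {}"

definition restrict_game :: "('a, 'b) game \<Rightarrow> 'a set \<Rightarrow> 'b set \<Rightarrow> ('a, 'b) game" where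
  "restrict_game G B1 B2 = G\<lparr>strats1 := B1, strats2 := B2\<rparr>"

definition mixed :: "'a set \<Rightarrow> 'a pmf set" where
  "mixed A = {\<sigma>. set_pmf \<sigma> \<subseteq> A}"

definition mutil1 :: "('a, 'b) game \<Rightarrow> 'a pmf \<Rightarrow> 'b pmf \<Rightarrow> real" where
  "mutil1 G \<sigma> \<tau> =
     (\<Sum>c\<in>strats1 G. \<Sum>d\<in>strats2 G. pmf \<sigma> c * pmf \<tau> d * util1 G c d)"

definition mutil2 :: "('a, 'b) game \<Rightarrow> 'a pmf \<Rightarrow> 'b pmf \<Rightarrow> real" where
  "mutil2 G \<sigma> \<tau> =
     (\<Sum>c\<in>strats1 G. \<Sum>d\<in>strats2 G. pmf \<sigma> c * pmf \<tau> d * util2 G c d)"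

definition nash :: "('a, 'b) game \<Rightarrow> 'a pmf \<Rightarrow> 'b pmf \<Rightarrow> bool" where
  "nash G \<sigma> \<tau> \<longleftrightarrow>
     \<sigma> \<in> mixed (strats1 G) \<and> \<tau> \<in> mixed (strats2 G) \<and>
     (\<forall>\<sigma>'\<in>mixed (strats1 G). mutil1 G \<sigma>' \<tau> \<le> mutil1 G \<sigma> \<tau>) \<and>
     (\<forall>\<tau>'\<in>mixed (strats2 G). mutil2 G \<sigma> \<tau>' \<le> mutil2 G \<sigma> \<tau>)"

definition completely_mixed_nash :: "('a, 'b) game \<Rightarrow> 'a pmf \<Rightarrow> 'b pmf \<Rightarrow> bool" where
  "completely_mixed_nash G \<sigma> \<tau> \<longleftrightarrow>
     nash G \<sigma> \<tau> \<and> (\<forall>c\<in>strats1 G. pmf \<sigma> c > 0) \<and> (\<forall>d\<in>strats2 G. pmf \<tau> d > 0)"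

definition equal_supports :: "('a, 'b) game \<Rightarrow> bool" where
  "equal_supports G \<longleftrightarrow>
     (\<forall>B1 B2 \<sigma> \<tau>. B1 \<noteq> {} \<and> B1 \<subseteq> strats1 G \<and> B2 \<noteq> {} \<and> B2 \<subseteq> strats2 G \<and>
        nash (restrict_game G B1 B2) \<sigma> \<tau> \<longrightarrow> card (set_pmf \<sigma>) = card (set_pmf \<tau>))"

definition distinct_components :: "('a, 'b) game \<Rightarrow> bool" where
  "distinct_components G \<longleftrightarrow>
     (\<forall>B1 B2 B2' \<sigma> \<tau> \<sigma>' \<tau>'.
        B1 \<subseteq> strats1 G \<and> B2 \<subseteq> strats2 G \<and> B2' \<subseteq> strats2 G \<and>
        card B1 = card B2 \<and> card B2 = card B2' \<and> 2 \<le> card B1 \<and> B2 \<inter> B2' = {} \<and>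
        completely_mixed_nash (restrict_game G B1 B2) \<sigma> \<tau> \<and>
        completely_mixed_nash (restrict_game G B1 B2') \<sigma>' \<tau>' \<longrightarrow> \<sigma> \<noteq> \<sigma>') \<and>
     (\<forall>B2 B1 B1' \<sigma> \<tau> \<sigma>' \<tau>'.
        B2 \<subseteq> strats2 G \<and> B1 \<subseteq> strats1 G \<and> B1' \<subseteq> strats1 G \<and>
        card B2 = card B1 \<and> card B1 = card B1' \<and> 2 \<le> card B2 \<and> B1 \<inter> B1' = {} \<and>
        completely_mixed_nash (restrict_game G B1 B2) \<sigma> \<tau> \<and>
        completely_mixed_nash (restrict_game G B1' B2) \<sigma>' \<tau>' \<longrightarrow> \<tau> \<noteq> \<tau>')"

definition deviation_plan :: "'a set \<Rightarrow> ('a \<Rightarrow> 'a pmf) \<Rightarrow> bool" where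
  "deviation_plan C \<alpha> \<longleftrightarrow> (\<forall>c\<in>C. \<alpha> c \<in> mixed C)"

definition dual_vector ::
  "('a, 'b) game \<Rightarrow> ('a \<Rightarrow> 'a pmf) \<Rightarrow> ('b \<Rightarrow> 'b pmf) \<Rightarrow> bool" where
  "dual_vector G \<alpha>1 \<alpha>2 \<longleftrightarrow>
     deviation_plan (strats1 G) \<alpha>1 \<and> deviation_plan (strats2 G) \<alpha>2 \<and>
     (\<forall>c\<in>strats1 G. \<forall>d\<in>strats2 G.
        (mutil1 G (\<alpha>1 c) (return_pmf d) - util1 G c d) +
        (mutil2 G (return_pmf c) (\<alpha>2 d) - util2 G c d) \<ge> 0)"

definition full_dual_vector ::
  "('a, 'b) game \<Rightarrow> ('a \<Rightarrow> 'a pmf) \<Rightarrow> ('b \<Rightarrow> 'b pmf) \<Rightarrow> bool" where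
  "full_dual_vector G \<alpha>1 \<alpha>2 \<longleftrightarrow>
     dual_vector G \<alpha>1 \<alpha>2 \<and>
     (\<forall>\<beta>1 \<beta>2. dual_vector G \<beta>1 \<beta>2 \<longrightarrow>
        (\<forall>c\<in>strats1 G. \<forall>d\<in>strats1 G. pmf (\<beta>1 c) d > 0 \<longrightarrow> pmf (\<alpha>1 c) d > 0) \<and>
        (\<forall>c\<in>strats2 G. \<forall>d\<in>strats2 G. pmf (\<beta>2 c) d > 0 \<longrightarrow> pmf (\<alpha>2 c) d > 0))"

definition absorbing :: "'a set \<Rightarrow> ('a \<Rightarrow> 'a pmf) \<Rightarrow> 'a set \<Rightarrow> bool" where
  "absorbing C \<alpha> B \<longleftrightarrow> B \<noteq> {} \<and> B \<subseteq> C \<and> (\<forall>c\<in>B. set_pmf (\<alpha> c) \<subseteq> B)"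

definition minimal_absorbing :: "'a set \<Rightarrow> ('a \<Rightarrow> 'a pmf) \<Rightarrow> 'a set \<Rightarrow> bool" where
  "minimal_absorbing C \<alpha> B \<longleftrightarrow> absorbing C \<alpha> B \<and> (\<forall>B'. B' \<subset> B \<longrightarrow> \<not> absorbing C \<alpha> B')"

text \<open>The mixture of the strategies \<open>\<alpha> c\<close> with weights \<open>\<sigma> c\<close> is \<open>bind_pmf \<sigma> \<alpha>\<close>.\<close>

definition stationary :: "('a \<Rightarrow> 'a pmf) \<Rightarrow> 'a pmf \<Rightarrow> bool" where
  "stationary \<alpha> \<sigma> \<longleftrightarrow> bind_pmf \<sigma> \<alpha> = \<sigma>"

definition reduced_strats :: "'a set \<Rightarrow> ('a \<Rightarrow> 'a pmf) \<Rightarrow> 'a pmf set" where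
  "reduced_strats C \<alpha> =
     {\<sigma> \<in> mixed C. stationary \<alpha> \<sigma> \<and> (\<exists>B. minimal_absorbing C \<alpha> B \<and> set_pmf \<sigma> \<subseteq> B)}"

definition dual_reduction ::
  "('a, 'b) game \<Rightarrow> ('a \<Rightarrow> 'a pmf) \<Rightarrow> ('b \<Rightarrow> 'b pmf) \<Rightarrow> ('a pmf, 'b pmf) game" where
  "dual_reduction G \<alpha>1 \<alpha>2 =
     \<lparr>strats1 = reduced_strats (strats1 G) \<alpha>1,
      strats2 = reduced_strats (strats2 G) \<alpha>2,
      util1 = mutil1 G,
      util2 = mutil2 G\<rparr>"

definition full_dual_reduction :: "('a, 'b) game \<Rightarrow> ('a pmf, 'b pmf) game \<Rightarrow> bool" where
  "full_dual_reduction G H \<longleftrightarrow>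
     (\<exists>\<alpha>1 \<alpha>2. full_dual_vector G \<alpha>1 \<alpha>2 \<and> H = dual_reduction G \<alpha>1 \<alpha>2)"

text \<open>A dual reduction changes the type of the pure strategies from \<open>'a\<close> to \<open>'a pmf\<close>, so
  a sequence of iterated reductions needs a type that is closed under forming mixed strategies.
  The constructor \<open>Mix\<close> turns a mixed strategy of one game into a pure strategy of
  the next; \<open>base_game\<close> and \<open>mix_game\<close> relabel pure strategies along the two (injective)
  constructors and leave the game otherwise unchanged. Outside the strategy sets
  the relabelled utilities are irrelevant, but they are determined by the game that is relabelled,
  so equality of games below amounts to equality of the strategy sets and of the
  utilities on them.\<close>

datatype 'a strat = Base (un_Base: 'a) | Mix (un_Mix: "'a strat pmf")

definition base_game :: "('a, 'b) game \<Rightarrow> ('a strat, 'b strat) game" where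
  "base_game G =
     \<lparr>strats1 = Base ` strats1 G,
      strats2 = Base ` strats2 G,
      util1 = (\<lambda>x y. util1 G (un_Base x) (un_Base y)),
      util2 = (\<lambda>x y. util2 G (un_Base x) (un_Base y))\<rparr>"

definition mix_game :: "('a strat pmf, 'b strat pmf) game \<Rightarrow> ('a strat, 'b strat) game" where
  "mix_game G =
     \<lparr>strats1 = Mix ` strats1 G,
      strats2 = Mix ` strats2 G,
      util1 = (\<lambda>x y. util1 G (un_Mix x) (un_Mix y)),
      util2 = (\<lambda>x y. util2 G (un_Mix x) (un_Mix y))\<rparr>"

definition iterative_full_dual_reductions ::
  "('a, 'b) game \<Rightarrow> (nat \<Rightarrow> ('a strat, 'b strat) game) \<Rightarrow> bool" where
  "iterative_full_dual_reductions G \<Gamma> \<longleftrightarrow>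
     \<Gamma> 0 = base_game G \<and>
     (\<forall>k. \<exists>H. full_dual_reduction (\<Gamma> k) H \<and> \<Gamma> (Suc k) = mix_game H)"

end

theory Submission
  imports Defs
begin

text \<open>
  All full dual vectors of a game put positive weight on the same deviations, so they have the same
  minimal absorbing sets. Two full dual reductions can therefore differ only in the stationary
  strategies that sit on these sets.

  Let \<open>\<sigma>\<close> and \<open>\<tau>\<close> be stationary strategies of the two players on minimal absorbing sets. Averaging
  the dual inequality over \<open>\<tau>\<close> cancels the second player's term, so against \<open>\<tau>\<close> following the
  deviation plan never costs the first player anything. His payoff against \<open>\<tau>\<close> is thus
  subharmonic for the Markov chain of his deviation plan, hence constant on each of
  his minimal absorbing sets (\<open>minimal_absorbing_indifferent\<close>). By symmetry, \<open>(\<sigma>, \<tau>)\<close> is a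
  completely mixed equilibrium of the game restricted to the two supports. If a second
  strategy with the support of \<open>\<sigma>\<close> also made the second player indifferent, then on
  the line through both there would be one with a smaller support, still in equilibrium with
  \<open>\<tau>\<close>, against the condition of equal supports (\<open>indifferent1_unique\<close>). So the stationary
  strategies, and with them the full dual reduction, are determined by the game.

  To iterate, both conditions on the game must survive a reduction
  (\<open>generic_game_full_dual_reduction\<close>). Equal supports force all minimal absorbing sets of both
  players to have one common size. If it is 1, the reduction is a restriction of the game with its
  strategies renamed. If it is at least 2, two disjoint minimal absorbing sets of one player would
  give two completely mixed equilibria that share the opponent's strategy, which the second condition
  forbids; each player then has a single strategy left, and both conditions hold trivially.

  Existence rests on two constructions: averaging finitely many dual vectors gives a full one
  (\<open>ex_full_dual_vector\<close>), and eliminating states one by one gives a stationary distribution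
  (\<open>ex_stationary_weights\<close>).
\<close>

section \<open>Finitely supported distributions\<close>

lemma pmf_bind_finite:
  assumes "finite A" "set_pmf p \<subseteq> A"
  shows "pmf (bind_pmf p f) c = (\<Sum>x\<in>A. pmf p x * pmf (f x) c)"
  unfolding pmf_bind
  by (subst integral_measure_pmf_real[OF assms(1)]) (use assms(2) in \<open>auto simp: mult.commute\<close>)

lemma sum_pmf_mixed:
  assumes "finite A" "\<sigma> \<in> mixed A"
  shows "(\<Sum>c\<in>A. pmf \<sigma> c) = 1"
  using assms by (auto simp: mixed_def intro: sum_pmf_eq_1)

lemma pmf_mixed_eq_0: "\<sigma> \<in> mixed A \<Longrightarrow> c \<notin> A \<Longrightarrow> pmf \<sigma> c = 0"
  by (auto simp: mixed_def set_pmf_eq)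

lemma ex_pmf_of_weights:
  fixes w :: "'a \<Rightarrow> real"
  assumes "finite A" "\<And>c. c \<in> A \<Longrightarrow> 0 \<le> w c" "(\<Sum>c\<in>A. w c) = 1"
  obtains \<sigma> where "\<sigma> \<in> mixed A" "\<And>c. c \<in> A \<Longrightarrow> pmf \<sigma> c = w c"
proof -
  define f where "f c = (if c \<in> A then w c else 0)" for c
  have nn: "0 \<le> f c" for c
    using assms(2) by (simp add: f_def)
  have "(\<integral>\<^sup>+ c. ennreal (f c) \<partial>count_space UNIV) = (\<Sum>c\<in>A. ennreal (f c))"
    by (rule nn_integral_count_space') (auto simp: f_def assms(1))
  also have "\<dots> = ennreal (\<Sum>c\<in>A. f c)"
    by (rule sum_ennreal) (rule nn)
  also have "(\<Sum>c\<in>A. f c) = 1"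
    using assms(3) by (simp add: f_def)
  finally have "pmf (embed_pmf f) c = f c" for c
    by (intro pmf_embed_pmf) (auto simp: nn)
  then show thesis
    by (intro that[of "embed_pmf f"]) (auto simp: mixed_def set_pmf_eq f_def split: if_splits)
qed

section \<open>Stationary distributions of finite Markov chains\<close>

text \<open>Induction on the number of states by censoring: the chain watched only while it is outside a state \<open>z\<close>
that it can leave is again a Markov chain. A stationary distribution of the watched chain extends to \<open>z\<close>,
where the flow into \<open>z\<close> dictates the weight.\<close>

lemma ex_stationary_weights:
  fixes P :: "'a \<Rightarrow> 'a \<Rightarrow> real"
  assumes "finite B" "B \<noteq> {}"
    and "\<And>c d. c \<in> B \<Longrightarrow> d \<in> B \<Longrightarrow> 0 \<le> P c d"
    and "\<And>c. c \<in> B \<Longrightarrow> (\<Sum>d\<in>B. P c d) = 1"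
  shows "\<exists>w. (\<forall>c\<in>B. 0 \<le> w c) \<and> (\<Sum>c\<in>B. w c) = 1 \<and>
             (\<forall>d\<in>B. (\<Sum>c\<in>B. w c * P c d) = w d)"
  using assms
proof (induction B arbitrary: P rule: finite_ne_induct)
  case (singleton z)
  then show ?case by (intro exI[of _ "\<lambda>_. 1"]) auto
next
  case (insert z B)
  have row: "P c z + (\<Sum>d\<in>B. P c d) = 1" if "c \<in> insert z B" for c
    using insert.prems(2)[OF that] insert.hyps by simp
  have nn: "0 \<le> P c d" if "c \<in> insert z B" "d \<in> insert z B" for c d
    using insert.prems(1) that by blast
  show ?case
  proof (cases "P z z = 1")
    case True
    \<comment> \<open>The state \<open>z\<close> is absorbing, so the point mass at \<open>z\<close> is stationary.\<close>
    then have "(\<Sum>d\<in>B. P z d) = 0"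
      using row[of z] by simp
    then have "\<forall>d\<in>B. P z d = 0"
      using insert.hyps nn by (subst (asm) sum_nonneg_eq_0_iff) auto
    moreover have "(\<Sum>c\<in>B. (if c = z then 1 else 0) * g c) = 0" for g :: "'a \<Rightarrow> real"
      using insert.hyps by (intro sum.neutral) auto
    ultimately show ?thesis
      using True insert.hyps by (intro exI[of _ "\<lambda>c. if c = z then 1 else 0"]) (auto simp: sum.neutral)
  next
    case False
    define q where "q = 1 - P z z"
    have q: "(\<Sum>d\<in>B. P z d) = q"
      using row[of z] by (simp add: q_def)
    have "0 \<le> q"
      unfolding q[symmetric] using nn by (intro sum_nonneg) auto
    with False have q_pos: "q > 0"
      by (simp add: q_def)
    \<comment> \<open>A visit to \<open>z\<close> ends after a geometric time, and \<open>P z d / q\<close> is the probability that it ends in \<open>d\<close>.\<close>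
    define P' where "P' c d = P c d + P c z * P z d / q" for c d
    have "\<exists>w. (\<forall>c\<in>B. 0 \<le> w c) \<and> (\<Sum>c\<in>B. w c) = 1 \<and> (\<forall>d\<in>B. (\<Sum>c\<in>B. w c * P' c d) = w d)"
    proof (rule insert.IH)
      fix c d assume "c \<in> B" "d \<in> B"
      then show "0 \<le> P' c d"
        using nn q_pos by (auto simp: P'_def)
    next
      fix c assume c: "c \<in> B"
      have "(\<Sum>d\<in>B. P' c d) = (\<Sum>d\<in>B. P c d) + P c z * (\<Sum>d\<in>B. P z d) / q"
        by (simp add: P'_def sum.distrib sum_distrib_left sum_divide_distrib)
      then show "(\<Sum>d\<in>B. P' c d) = 1"
        using row[of c] c q q_pos by simp
    qed
    then obtain w where w: "\<forall>c\<in>B. 0 \<le> w c" "(\<Sum>c\<in>B. w c) = 1"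
        "\<forall>d\<in>B. (\<Sum>c\<in>B. w c * P' c d) = w d"
      by blast
    \<comment> \<open>The balance equation at \<open>z\<close> reads \<open>s * q = (\<Sum>c\<in>B. w c * P c z)\<close>; dividing by \<open>1 + s\<close> restores
      total weight one.\<close>
    define s where "s = (\<Sum>c\<in>B. w c * P c z) / q"
    have s: "(\<Sum>c\<in>B. w c * P c z) = s * q"
      using q_pos by (simp add: s_def)
    have s_nn: "0 \<le> s"
      unfolding s_def using q_pos w(1) nn by (intro divide_nonneg_pos sum_nonneg mult_nonneg_nonneg) auto
    define v where "v c = (if c = z then s else w c) / (1 + s)" for c
    have vB: "(\<Sum>c\<in>B. v c * g c) = (\<Sum>c\<in>B. w c * g c) / (1 + s)" for g :: "'a \<Rightarrow> real"
      unfolding sum_divide_distrib v_def using insert.hyps by (intro sum.cong) auto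
    have step: "(\<Sum>c\<in>insert z B. v c * P c d) = (s * P z d + (\<Sum>c\<in>B. w c * P c d)) / (1 + s)" for d
      using insert.hyps by (simp add: vB add_divide_distrib) (simp add: v_def)
    have "(\<Sum>c\<in>insert z B. v c * P c d) = v d" if d: "d \<in> insert z B" for d
    proof (cases "d = z")
      case True
      have "s * P z z + s * q = s"
        by (simp add: q_def algebra_simps)
      with True show ?thesis
        using step[of z] by (simp add: s v_def)
    next
      case False
      with d have "w d = (\<Sum>c\<in>B. w c * P' c d)"
        using w(3) by simp
      also have "\<dots> = (\<Sum>c\<in>B. w c * P c d) + s * P z d"
        by (simp add: P'_def s_def algebra_simps sum.distrib sum_distrib_left sum_divide_distrib)
      finally show ?thesis
        using step[of d] False by (simp add: v_def add.commute)
    qed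
    moreover have "(\<Sum>c\<in>insert z B. v c) = 1"
      using vB[of "\<lambda>_. 1"] insert.hyps w(2) s_nn by (simp add: v_def add_divide_distrib[symmetric])
    moreover have "\<forall>c\<in>insert z B. 0 \<le> v c"
      using w(1) s_nn by (simp add: v_def)
    ultimately show ?thesis by blast
  qed
qed

lemma minimal_absorbing_eqI:
  assumes "minimal_absorbing C \<alpha> B" "absorbing C \<alpha> B'" "B' \<subseteq> B"
  shows "B' = B"
  using assms by (auto simp: minimal_absorbing_def psubset_eq)

text \<open>The support of a stationary distribution is closed under the chain, so a stationary distribution
inside a minimal absorbing set fills it.\<close>

lemma reduced_strats_minimal_absorbing:
  assumes "\<sigma> \<in> reduced_strats C \<alpha>"
  shows "minimal_absorbing C \<alpha> (set_pmf \<sigma>)"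
proof -
  from assms obtain B where B: "minimal_absorbing C \<alpha> B" "set_pmf \<sigma> \<subseteq> B"
    and st: "bind_pmf \<sigma> \<alpha> = \<sigma>" and mx: "set_pmf \<sigma> \<subseteq> C"
    by (auto simp: reduced_strats_def stationary_def mixed_def)
  have "(\<Union>c\<in>set_pmf \<sigma>. set_pmf (\<alpha> c)) = set_pmf \<sigma>"
    using arg_cong[OF st, of set_pmf] by simp
  then have "absorbing C \<alpha> (set_pmf \<sigma>)"
    using mx by (auto simp: absorbing_def set_pmf_not_empty)
  with B have "set_pmf \<sigma> = B"
    by (intro minimal_absorbing_eqI)
  with B show ?thesis by simp
qed

lemma ex_reduced_strat:
  assumes "finite C" "minimal_absorbing C \<alpha> B"
  shows "\<exists>\<sigma>\<in>reduced_strats C \<alpha>. set_pmf \<sigma> = B"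
proof -
  have B: "B \<noteq> {}" "B \<subseteq> C" "\<And>c. c \<in> B \<Longrightarrow> set_pmf (\<alpha> c) \<subseteq> B"
    using assms(2) by (auto simp: minimal_absorbing_def absorbing_def)
  have fin: "finite B"
    using B(2) assms(1) finite_subset by blast
  have "\<exists>w. (\<forall>c\<in>B. 0 \<le> w c) \<and> (\<Sum>c\<in>B. w c) = 1 \<and>
             (\<forall>d\<in>B. (\<Sum>c\<in>B. w c * pmf (\<alpha> c) d) = w d)"
    by (rule ex_stationary_weights) (use fin B in \<open>auto simp: sum_pmf_eq_1\<close>)
  then obtain w where w: "\<forall>c\<in>B. 0 \<le> w c" "(\<Sum>c\<in>B. w c) = 1"
      "\<forall>d\<in>B. (\<Sum>c\<in>B. w c * pmf (\<alpha> c) d) = w d"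
    by blast
  obtain \<sigma> where \<sigma>: "\<sigma> \<in> mixed B" "\<And>c. c \<in> B \<Longrightarrow> pmf \<sigma> c = w c"
    using ex_pmf_of_weights[OF fin, of w] w by blast
  have sub: "set_pmf \<sigma> \<subseteq> B"
    using \<sigma>(1) by (simp add: mixed_def)
  have "bind_pmf \<sigma> \<alpha> = \<sigma>"
  proof (rule pmf_eqI)
    fix d
    have "pmf (bind_pmf \<sigma> \<alpha>) d = (\<Sum>c\<in>B. w c * pmf (\<alpha> c) d)"
      using pmf_bind_finite[OF fin sub] \<sigma>(2) by simp
    also have "\<dots> = pmf \<sigma> d"
    proof (cases "d \<in> B")
      case False
      then have "pmf (\<alpha> c) d = 0" if "c \<in> B" for c
        using B(3)[OF that] by (auto simp: set_pmf_eq)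
      then show ?thesis
        using False pmf_mixed_eq_0[OF \<sigma>(1)] by simp
    qed (use w(3) \<sigma>(2) in simp)
    finally show "pmf (bind_pmf \<sigma> \<alpha>) d = pmf \<sigma> d" .
  qed
  then have mem: "\<sigma> \<in> reduced_strats C \<alpha>"
    using sub B(2) assms(2) by (auto simp: reduced_strats_def mixed_def stationary_def)
  have "set_pmf \<sigma> = B"
    using reduced_strats_minimal_absorbing[OF mem] assms(2) sub
    by (intro minimal_absorbing_eqI) (auto simp: minimal_absorbing_def)
  with mem show ?thesis by blast
qed

lemma ex_minimal_absorbing:
  assumes "finite C" "C \<noteq> {}" "deviation_plan C \<alpha>"
  shows "\<exists>B. minimal_absorbing C \<alpha> B"
proof -
  let ?X = "{B. absorbing C \<alpha> B}"
  have "?X \<subseteq> Pow C"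
    by (auto simp: absorbing_def)
  then have "finite ?X"
    using assms(1) finite_subset by blast
  moreover have "C \<in> ?X"
    using assms by (auto simp: absorbing_def deviation_plan_def mixed_def)
  ultimately obtain B where "B \<in> ?X" "\<forall>B'\<in>?X. B' \<subseteq> B \<longrightarrow> B = B'"
    using finite_has_minimal2[of ?X C] by blast
  then show ?thesis
    unfolding minimal_absorbing_def by blast
qed

lemma minimal_absorbing_disjoint:
  assumes "minimal_absorbing C \<alpha> B" "minimal_absorbing C \<alpha> B'" "B \<noteq> B'"
  shows "B \<inter> B' = {}"
proof (rule ccontr)
  assume "B \<inter> B' \<noteq> {}"
  with assms have "absorbing C \<alpha> (B \<inter> B')"
    unfolding minimal_absorbing_def absorbing_def by blast
  then have "B \<inter> B' = B" "B \<inter> B' = B'"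
    using minimal_absorbing_eqI[OF assms(1)] minimal_absorbing_eqI[OF assms(2)] by simp_all
  with assms(3) show False by simp
qed

text \<open>Maximum principle: where a subharmonic function attains its maximum, it does so at all successors too, so
the maximizers form an absorbing set.\<close>

lemma subharmonic_constant:
  fixes f :: "'a \<Rightarrow> real"
  assumes "finite C" "minimal_absorbing C \<alpha> B"
    and "\<And>c. c \<in> B \<Longrightarrow> f c \<le> (\<Sum>d\<in>B. pmf (\<alpha> c) d * f d)"
    and "c \<in> B" "c' \<in> B"
  shows "f c = f c'"
proof -
  have B: "B \<noteq> {}" "B \<subseteq> C" "\<And>c. c \<in> B \<Longrightarrow> set_pmf (\<alpha> c) \<subseteq> B"
    using assms(2) by (auto simp: minimal_absorbing_def absorbing_def)
  have fin: "finite B"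
    using B(2) assms(1) finite_subset by blast
  define m where "m = Max (f ` B)"
  have le: "f d \<le> m" if "d \<in> B" for d
    using fin that by (simp add: m_def)
  have "absorbing C \<alpha> {d\<in>B. f d = m}"
    unfolding absorbing_def
  proof (intro conjI ballI subsetI)
    have "m \<in> f ` B"
      unfolding m_def using fin B(1) by (intro Max_in) auto
    then show "{d\<in>B. f d = m} \<noteq> {}" by auto
  next
    fix c d assume c: "c \<in> {d\<in>B. f d = m}" and d: "d \<in> set_pmf (\<alpha> c)"
    have nn: "0 \<le> pmf (\<alpha> c) d * (m - f d)" if "d \<in> B" for d
      using le[OF that] by simp
    have "(\<Sum>d\<in>B. pmf (\<alpha> c) d * (m - f d)) = m * (\<Sum>d\<in>B. pmf (\<alpha> c) d) - (\<Sum>d\<in>B. pmf (\<alpha> c) d * f d)"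
      by (simp add: algebra_simps sum_subtractf sum_distrib_left)
    also have "\<dots> \<le> 0"
      using assms(3)[of c] c sum_pmf_eq_1[OF fin B(3)[of c]] by simp
    finally have "(\<Sum>d\<in>B. pmf (\<alpha> c) d * (m - f d)) = 0"
      by (rule antisym) (intro sum_nonneg nn)
    then have "\<forall>d\<in>B. pmf (\<alpha> c) d * (m - f d) = 0"
      using sum_nonneg_eq_0_iff[OF fin nn] by simp
    moreover have "d \<in> B"
      using B(3)[of c] c d by blast
    ultimately show "d \<in> {d\<in>B. f d = m}"
      using d by (auto simp: set_pmf_eq)
  qed (use B(2) in auto)
  with assms(2) have "{d\<in>B. f d = m} = B"
    by (rule minimal_absorbing_eqI) auto
  then have "f d = m" if "d \<in> B" for d
    using that by blast
  with assms(4,5) show ?thesis by simp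
qed

section \<open>Exchanging the players\<close>

text \<open>All notions are symmetric in the players, so a statement about the first player, applied to the swapped
game, is one about the second.\<close>

definition swap_game :: "('a, 'b) game \<Rightarrow> ('b, 'a) game" where
  "swap_game G = \<lparr>strats1 = strats2 G, strats2 = strats1 G,
     util1 = (\<lambda>d c. util2 G c d), util2 = (\<lambda>d c. util1 G c d)\<rparr>"

lemma swap_game_simps [simp]:
  "strats1 (swap_game G) = strats2 G" "strats2 (swap_game G) = strats1 G"
  "util1 (swap_game G) d c = util2 G c d" "util2 (swap_game G) d c = util1 G c d"
  by (simp_all add: swap_game_def)

lemma mutil_swap [simp]:
  "mutil1 (swap_game G) \<tau> \<sigma> = mutil2 G \<sigma> \<tau>" "mutil2 (swap_game G) \<tau> \<sigma> = mutil1 G \<sigma> \<tau>"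
  unfolding mutil1_def mutil2_def
  by (subst sum.swap, simp add: mult.commute mult.left_commute)+

lemma restrict_game_simps [simp]:
  "strats1 (restrict_game G B1 B2) = B1" "strats2 (restrict_game G B1 B2) = B2"
  "util1 (restrict_game G B1 B2) = util1 G" "util2 (restrict_game G B1 B2) = util2 G"
  by (simp_all add: restrict_game_def)

lemma restrict_swap: "restrict_game (swap_game G) B2 B1 = swap_game (restrict_game G B1 B2)"
  by (simp add: restrict_game_def swap_game_def)

lemma nash_swap [simp]: "nash (swap_game G) \<tau> \<sigma> \<longleftrightarrow> nash G \<sigma> \<tau>"
  by (auto simp: nash_def)

lemma completely_mixed_nash_swap [simp]:
  "completely_mixed_nash (swap_game G) \<tau> \<sigma> \<longleftrightarrow> completely_mixed_nash G \<sigma> \<tau>"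
  by (auto simp: completely_mixed_nash_def)

lemma finite_game_swap [simp]: "finite_game (swap_game G) \<longleftrightarrow> finite_game G"
  by (auto simp: finite_game_def)

lemma equal_supports_swap: "equal_supports G \<Longrightarrow> equal_supports (swap_game G)"
  unfolding equal_supports_def restrict_swap nash_swap swap_game_simps by metis

lemma distinct_components_swap:
  assumes "distinct_components G"
  shows "distinct_components (swap_game G)"
proof -
  note halves = assms[unfolded distinct_components_def]
  show ?thesis
    unfolding distinct_components_def restrict_swap completely_mixed_nash_swap swap_game_simps
    apply (intro conjI allI impI)
     apply (rule conjunct2[OF halves, rule_format], assumption)
    apply (rule conjunct1[OF halves, rule_format], assumption)
    done
qed

lemma dual_vector_swap [simp]: "dual_vector (swap_game G) \<alpha>2 \<alpha>1 \<longleftrightarrow> dual_vector G \<alpha>1 \<alpha>2"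
  by (auto simp: dual_vector_def add.commute)

lemma full_dual_vector_swap: "full_dual_vector G \<alpha>1 \<alpha>2 \<Longrightarrow> full_dual_vector (swap_game G) \<alpha>2 \<alpha>1"
  by (auto simp: full_dual_vector_def)

section \<open>Expected utilities\<close>

lemma mutil1_bind_left:
  assumes "finite A" "set_pmf p \<subseteq> A"
  shows "mutil1 G (bind_pmf p f) \<tau> = (\<Sum>x\<in>A. pmf p x * mutil1 G (f x) \<tau>)"
proof -
  have "mutil1 G (bind_pmf p f) \<tau> =
      (\<Sum>c\<in>strats1 G. \<Sum>d\<in>strats2 G. \<Sum>x\<in>A. pmf p x * (pmf (f x) c * pmf \<tau> d * util1 G c d))"
    by (simp add: mutil1_def pmf_bind_finite[OF assms] sum_distrib_right mult.assoc)
  also have "\<dots> = (\<Sum>c\<in>strats1 G. \<Sum>x\<in>A. \<Sum>d\<in>strats2 G. pmf p x * (pmf (f x) c * pmf \<tau> d * util1 G c d))"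
    by (intro sum.cong refl sum.swap)
  also have "\<dots> = (\<Sum>x\<in>A. \<Sum>c\<in>strats1 G. \<Sum>d\<in>strats2 G. pmf p x * (pmf (f x) c * pmf \<tau> d * util1 G c d))"
    by (rule sum.swap)
  finally show ?thesis
    by (simp add: mutil1_def sum_distrib_left)
qed

lemma mutil2_bind_left:
  assumes "finite A" "set_pmf p \<subseteq> A"
  shows "mutil2 G (bind_pmf p f) \<tau> = (\<Sum>x\<in>A. pmf p x * mutil2 G (f x) \<tau>)"
  using mutil1_bind_left[OF assms, of "\<lparr>strats1 = strats1 G, strats2 = strats2 G, util1 = util2 G, util2 = util1 G\<rparr>" f \<tau>]
  by (simp add: mutil1_def mutil2_def)

lemma mutil1_bind_right:
  assumes "finite A" "set_pmf p \<subseteq> A"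
  shows "mutil1 G \<sigma> (bind_pmf p f) = (\<Sum>x\<in>A. pmf p x * mutil1 G \<sigma> (f x))"
  using mutil2_bind_left[OF assms, of "swap_game G" f \<sigma>] by simp

lemma mutil2_bind_right:
  assumes "finite A" "set_pmf p \<subseteq> A"
  shows "mutil2 G \<sigma> (bind_pmf p f) = (\<Sum>x\<in>A. pmf p x * mutil2 G \<sigma> (f x))"
  using mutil1_bind_left[OF assms, of "swap_game G" f \<sigma>] by simp

lemma mutil1_pure_left:
  assumes "finite A" "\<sigma> \<in> mixed A"
  shows "mutil1 G \<sigma> \<tau> = (\<Sum>c\<in>A. pmf \<sigma> c * mutil1 G (return_pmf c) \<tau>)"
  using mutil1_bind_left[of A \<sigma> G return_pmf \<tau>] assms by (simp add: mixed_def bind_return_pmf')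

lemma mutil2_pure_left:
  assumes "finite A" "\<sigma> \<in> mixed A"
  shows "mutil2 G \<sigma> \<tau> = (\<Sum>c\<in>A. pmf \<sigma> c * mutil2 G (return_pmf c) \<tau>)"
  using mutil2_bind_left[of A \<sigma> G return_pmf \<tau>] assms by (simp add: mixed_def bind_return_pmf')

lemma mutil1_return:
  assumes "finite_game G" "c \<in> strats1 G" "d \<in> strats2 G"
  shows "mutil1 G (return_pmf c) (return_pmf d) = util1 G c d"
proof -
  have "mutil1 G (return_pmf c) (return_pmf d) =
      (\<Sum>c'\<in>strats1 G. if c' = c then (\<Sum>d'\<in>strats2 G. if d' = d then util1 G c d else 0) else 0)"
    unfolding mutil1_def by (intro sum.cong refl) (auto intro!: sum.cong simp: indicator_def)
  then show ?thesis
    using assms by (simp add: finite_game_def)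
qed

lemma mutil2_return:
  assumes "finite_game G" "c \<in> strats1 G" "d \<in> strats2 G"
  shows "mutil2 G (return_pmf c) (return_pmf d) = util2 G c d"
  using mutil1_return[of "swap_game G" d c] assms by simp

lemma mutil1_restrict:
  assumes "finite_game G" "B1 \<subseteq> strats1 G" "B2 \<subseteq> strats2 G" "\<sigma> \<in> mixed B1" "\<tau> \<in> mixed B2"
  shows "mutil1 (restrict_game G B1 B2) \<sigma> \<tau> = mutil1 G \<sigma> \<tau>"
proof -
  have "(\<Sum>d\<in>B2. pmf \<sigma> c * pmf \<tau> d * util1 G c d) =
      (\<Sum>d\<in>strats2 G. pmf \<sigma> c * pmf \<tau> d * util1 G c d)" for c
    using assms by (intro sum.mono_neutral_left) (auto simp: finite_game_def pmf_mixed_eq_0)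
  moreover have "(\<Sum>c\<in>B1. \<Sum>d\<in>strats2 G. pmf \<sigma> c * pmf \<tau> d * util1 G c d) =
      (\<Sum>c\<in>strats1 G. \<Sum>d\<in>strats2 G. pmf \<sigma> c * pmf \<tau> d * util1 G c d)"
    using assms by (intro sum.mono_neutral_left) (auto simp: finite_game_def pmf_mixed_eq_0)
  ultimately show ?thesis
    by (simp add: mutil1_def)
qed

section \<open>Equilibria of restricted games\<close>

text \<open>The counterpart for the second player is \<open>indifferent1 (swap_game G) B \<sigma>\<close>.\<close>

definition indifferent1 :: "('a, 'b) game \<Rightarrow> 'a set \<Rightarrow> 'b pmf \<Rightarrow> bool" where
  "indifferent1 G B \<tau> \<longleftrightarrow>
     (\<forall>c\<in>B. \<forall>c'\<in>B. mutil1 G (return_pmf c) \<tau> = mutil1 G (return_pmf c') \<tau>)"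

lemma indifferent1_mutil1_eq:
  assumes "finite B" "indifferent1 G B \<tau>" "\<sigma> \<in> mixed B" "c \<in> B"
  shows "mutil1 G \<sigma> \<tau> = mutil1 G (return_pmf c) \<tau>"
proof -
  have "mutil1 G \<sigma> \<tau> = (\<Sum>c'\<in>B. pmf \<sigma> c' * mutil1 G (return_pmf c) \<tau>)"
    unfolding mutil1_pure_left[OF assms(1,3)]
    using assms(2,4) by (intro sum.cong refl) (metis indifferent1_def)
  also have "\<dots> = mutil1 G (return_pmf c) \<tau>"
    using sum_pmf_mixed[OF assms(1,3)] by (simp flip: sum_distrib_right)
  finally show ?thesis .
qed

lemma indifferent1_best_reply:
  assumes "finite_game G" "B1 \<subseteq> strats1 G" "B2 \<subseteq> strats2 G"
    and "\<sigma> \<in> mixed B1" "\<sigma>' \<in> mixed B1" "\<tau> \<in> mixed B2" "indifferent1 G B1 \<tau>"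
  shows "mutil1 (restrict_game G B1 B2) \<sigma>' \<tau> \<le> mutil1 (restrict_game G B1 B2) \<sigma> \<tau>"
proof -
  have fin: "finite B1"
    using assms(1,2) by (auto simp: finite_game_def finite_subset)
  obtain c where "c \<in> B1"
    using assms(4) set_pmf_not_empty[of \<sigma>] by (auto simp: mixed_def)
  then show ?thesis
    using indifferent1_mutil1_eq[OF fin assms(7)] assms by (simp add: mutil1_restrict)
qed

lemma nash_of_indifferent:
  assumes "finite_game G" "B1 \<subseteq> strats1 G" "B2 \<subseteq> strats2 G"
    and "\<sigma> \<in> mixed B1" "\<tau> \<in> mixed B2"
    and "indifferent1 G B1 \<tau>" "indifferent1 (swap_game G) B2 \<sigma>"
  shows "nash (restrict_game G B1 B2) \<sigma> \<tau>"
proof -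
  have "mutil1 (restrict_game G B1 B2) \<sigma>' \<tau> \<le> mutil1 (restrict_game G B1 B2) \<sigma> \<tau>"
    if "\<sigma>' \<in> mixed B1" for \<sigma>'
    using that assms by (intro indifferent1_best_reply)
  moreover have "mutil1 (restrict_game (swap_game G) B2 B1) \<tau>' \<sigma> \<le>
      mutil1 (restrict_game (swap_game G) B2 B1) \<tau> \<sigma>" if "\<tau>' \<in> mixed B2" for \<tau>'
    using that assms by (intro indifferent1_best_reply) auto
  ultimately show ?thesis
    using assms(4,5) by (simp add: nash_def restrict_swap)
qed

lemma equal_supportsD:
  assumes "equal_supports G" "nash (restrict_game G B1 B2) \<sigma> \<tau>"
    and "B1 \<noteq> {}" "B1 \<subseteq> strats1 G" "B2 \<noteq> {}" "B2 \<subseteq> strats2 G"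
  shows "card (set_pmf \<sigma>) = card (set_pmf \<tau>)"
  using assms unfolding equal_supports_def by blast

text \<open>Both \<open>\<sigma>\<close> and \<open>\<sigma>'\<close> are interior points of the same face of the simplex. If they differ, the line from
\<open>\<sigma>'\<close> through \<open>\<sigma>\<close> leaves the face at a point \<open>\<rho>\<close> of smaller support. The indifference of the second
player is preserved by affine combinations and holds at \<open>\<rho>\<close> too, so \<open>(\<rho>, \<tau>)\<close> is an equilibrium like
\<open>(\<sigma>, \<tau>)\<close>. Supports of equal size in both contradict each other.\<close>

lemma indifferent1_unique:
  fixes G :: "('a, 'b) game"
  assumes "finite_game G" "equal_supports G"
    and "set_pmf \<sigma> \<subseteq> strats1 G" "set_pmf \<sigma>' = set_pmf \<sigma>" "set_pmf \<tau> \<subseteq> strats2 G"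
    and "indifferent1 G (set_pmf \<sigma>) \<tau>"
    and ind: "indifferent1 (swap_game G) (set_pmf \<tau>) \<sigma>" "indifferent1 (swap_game G) (set_pmf \<tau>) \<sigma>'"
  shows "\<sigma> = \<sigma>'"
proof (rule ccontr)
  assume neq: "\<sigma> \<noteq> \<sigma>'"
  define B where "B = set_pmf \<sigma>"
  have fin: "finite B"
    using assms(1,3) by (auto simp: B_def finite_game_def finite_subset)
  have B: "B \<noteq> {}" "set_pmf \<sigma>' = B"
    using assms(4) by (simp_all add: B_def set_pmf_not_empty)
  have mx: "\<sigma> \<in> mixed B" "\<sigma>' \<in> mixed B" "\<tau> \<in> mixed (set_pmf \<tau>)"
    using B by (auto simp: mixed_def B_def)
  have pos: "pmf \<sigma>' c > 0" if "c \<in> B" for c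
    using that B(2) by (simp add: pmf_positive)
  have nash_card: "card (set_pmf \<rho>) = card (set_pmf \<tau>)"
    if "\<rho> \<in> mixed B" "indifferent1 (swap_game G) (set_pmf \<tau>) \<rho>" for \<rho>
  proof -
    have "nash (restrict_game G B (set_pmf \<tau>)) \<rho> \<tau>"
      using that assms mx by (intro nash_of_indifferent) (auto simp: B_def)
    then show ?thesis
      using equal_supportsD[OF assms(2)] assms(3,5) by (simp add: B_def set_pmf_not_empty)
  qed
  \<comment> \<open>The largest \<open>r\<close> for which \<open>\<sigma> - r * \<sigma>'\<close> stays nonnegative; it becomes zero at some \<open>z\<close>.\<close>
  define r where "r = Min ((\<lambda>c. pmf \<sigma> c / pmf \<sigma>' c) ` B)"
  have "r \<in> (\<lambda>c. pmf \<sigma> c / pmf \<sigma>' c) ` B"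
    unfolding r_def using fin B(1) by (intro Min_in) auto
  then obtain z where z: "z \<in> B" "r = pmf \<sigma> z / pmf \<sigma>' z"
    by blast
  have "r \<le> pmf \<sigma> c / pmf \<sigma>' c" if "c \<in> B" for c
    unfolding r_def using fin that by simp
  then have r_le: "r * pmf \<sigma>' c \<le> pmf \<sigma> c" if "c \<in> B" for c
    using pos[OF that] that by (simp flip: pos_le_divide_eq)
  have "r < 1"
  proof (rule ccontr)
    \<comment> \<open>Otherwise \<open>\<sigma>\<close> dominates \<open>\<sigma>'\<close> pointwise, and two distributions can only do so by being equal.\<close>
    assume "\<not> r < 1"
    have le: "pmf \<sigma>' c \<le> pmf \<sigma> c" if "c \<in> B" for c
    proof -
      have "1 * pmf \<sigma>' c \<le> r * pmf \<sigma>' c"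
        using \<open>\<not> r < 1\<close> by (intro mult_right_mono) auto
      with r_le[OF that] show ?thesis by simp
    qed
    have "(\<Sum>c\<in>B. pmf \<sigma> c - pmf \<sigma>' c) = 0"
      using sum_pmf_mixed[OF fin] mx by (simp add: sum_subtractf)
    then have "\<forall>c\<in>B. pmf \<sigma> c - pmf \<sigma>' c = 0"
      using le fin by (subst (asm) sum_nonneg_eq_0_iff) auto
    then have "pmf \<sigma> c = pmf \<sigma>' c" for c
      using mx by (cases "c \<in> B") (auto simp: pmf_mixed_eq_0)
    with neq show False
      by (simp add: pmf_eqI)
  qed
  obtain \<rho> where \<rho>: "\<rho> \<in> mixed B"
      "\<And>c. c \<in> B \<Longrightarrow> pmf \<rho> c = (pmf \<sigma> c - r * pmf \<sigma>' c) / (1 - r)"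
  proof (rule ex_pmf_of_weights[OF fin, of "\<lambda>c. (pmf \<sigma> c - r * pmf \<sigma>' c) / (1 - r)"])
    have "(\<Sum>c\<in>B. pmf \<sigma> c - r * pmf \<sigma>' c) = 1 - r"
      using sum_pmf_mixed[OF fin] mx by (simp add: sum_subtractf flip: sum_distrib_left)
    then show "(\<Sum>c\<in>B. (pmf \<sigma> c - r * pmf \<sigma>' c) / (1 - r)) = 1"
      using \<open>r < 1\<close> by (simp flip: sum_divide_distrib)
  qed (use r_le \<open>r < 1\<close> in \<open>auto intro!: divide_nonneg_pos\<close>)
  have payoff: "mutil2 G \<rho> \<tau>' = (mutil2 G \<sigma> \<tau>' - r * mutil2 G \<sigma>' \<tau>') / (1 - r)" for \<tau>'
    unfolding mutil2_pure_left[OF fin \<rho>(1)] mutil2_pure_left[OF fin mx(1)] mutil2_pure_left[OF fin mx(2)]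
      sum_distrib_left sum_subtractf[symmetric] sum_divide_distrib
    by (intro sum.cong refl) (simp add: \<rho>(2) left_diff_distrib mult.assoc)
  have "indifferent1 (swap_game G) (set_pmf \<tau>) \<rho>"
    using ind unfolding indifferent1_def mutil_swap payoff by metis
  then have "card (set_pmf \<rho>) = card B"
    using nash_card[of \<rho>] nash_card[of \<sigma>] \<rho>(1) ind(1) mx(1) by (simp add: B_def)
  moreover have "set_pmf \<rho> \<subseteq> B"
    using \<rho>(1) by (simp add: mixed_def)
  ultimately have "set_pmf \<rho> = B"
    using fin by (simp add: card_subset_eq)
  moreover have "pmf \<rho> z = 0"
    using \<rho>(2) z pos[of z] by simp
  ultimately show False
    using z(1) by (auto simp: set_pmf_eq)
qed

section \<open>Dual vectors\<close>

text \<open>In the average of the dual inequalities over \<open>d\<close> with weights \<open>\<tau> d\<close>, the gain of the second player is his payoff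
from \<open>\<tau>\<close> after deviation minus that from \<open>\<tau>\<close>, which is zero by stationarity. Only the
gain of the first player remains.\<close>

lemma stationary_deviation_profitable:
  assumes "finite_game G" "dual_vector G \<alpha>1 \<alpha>2"
    and "\<tau> \<in> mixed (strats2 G)" "stationary \<alpha>2 \<tau>" "c \<in> strats1 G"
  shows "mutil1 G (return_pmf c) \<tau> \<le> mutil1 G (\<alpha>1 c) \<tau>"
proof -
  have fin: "finite (strats2 G)" and \<tau>: "set_pmf \<tau> \<subseteq> strats2 G"
    using assms by (auto simp: finite_game_def mixed_def)
  have m2: "(\<Sum>d\<in>strats2 G. pmf \<tau> d * mutil2 G (return_pmf c) (\<alpha>2 d)) = mutil2 G (return_pmf c) \<tau>"
    using mutil2_bind_right[OF fin \<tau>, of G "return_pmf c" \<alpha>2] assms(4) by (simp add: stationary_def)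
  have split: "mutil1 G \<sigma> \<tau> = (\<Sum>d\<in>strats2 G. pmf \<tau> d * mutil1 G \<sigma> (return_pmf d))"
      "mutil2 G \<sigma> \<tau> = (\<Sum>d\<in>strats2 G. pmf \<tau> d * mutil2 G \<sigma> (return_pmf d))" for \<sigma>
    using mutil1_bind_right[OF fin \<tau>, of G \<sigma> return_pmf] mutil2_bind_right[OF fin \<tau>, of G \<sigma> return_pmf]
    by (simp_all add: bind_return_pmf')
  have "0 \<le> (\<Sum>d\<in>strats2 G. pmf \<tau> d *
      ((mutil1 G (\<alpha>1 c) (return_pmf d) - mutil1 G (return_pmf c) (return_pmf d)) +
       (mutil2 G (return_pmf c) (\<alpha>2 d) - mutil2 G (return_pmf c) (return_pmf d))))"
    using assms(1,2,5) by (intro sum_nonneg mult_nonneg_nonneg)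
      (auto simp: dual_vector_def mutil1_return mutil2_return)
  also have "\<dots> = mutil1 G (\<alpha>1 c) \<tau> - mutil1 G (return_pmf c) \<tau>"
    unfolding split(1) using m2 unfolding split(2)
    by (simp add: algebra_simps sum.distrib sum_subtractf)
  finally show ?thesis by simp
qed

text \<open>The payoff against \<open>\<tau>\<close> is subharmonic for the chain \<open>\<alpha>1\<close>, so the maximum principle applies.\<close>

lemma minimal_absorbing_indifferent:
  assumes "finite_game G" "dual_vector G \<alpha>1 \<alpha>2"
    and "minimal_absorbing (strats1 G) \<alpha>1 B" "\<tau> \<in> reduced_strats (strats2 G) \<alpha>2"
  shows "indifferent1 G B \<tau>"
  unfolding indifferent1_def
proof (intro ballI)
  fix c c' assume "c \<in> B" "c' \<in> B"
  have B: "B \<subseteq> strats1 G" "\<And>c. c \<in> B \<Longrightarrow> set_pmf (\<alpha>1 c) \<subseteq> B"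
    using assms(3) by (auto simp: minimal_absorbing_def absorbing_def)
  have fin: "finite (strats1 G)"
    using assms(1) by (simp add: finite_game_def)
  show "mutil1 G (return_pmf c) \<tau> = mutil1 G (return_pmf c') \<tau>"
  proof (rule subharmonic_constant[OF fin assms(3) _ \<open>c \<in> B\<close> \<open>c' \<in> B\<close>])
    fix c assume c: "c \<in> B"
    have "mutil1 G (return_pmf c) \<tau> \<le> mutil1 G (\<alpha>1 c) \<tau>"
      using assms(4) c B(1) by (intro stationary_deviation_profitable[OF assms(1,2)])
        (auto simp: reduced_strats_def)
    also have "\<dots> = (\<Sum>d\<in>B. pmf (\<alpha>1 c) d * mutil1 G (return_pmf d) \<tau>)"
      using B(2)[OF c] finite_subset[OF B(1) fin] by (intro mutil1_pure_left) (auto simp: mixed_def)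
    finally show "mutil1 G (return_pmf c) \<tau> \<le> (\<Sum>d\<in>B. pmf (\<alpha>1 c) d * mutil1 G (return_pmf d) \<tau>)" .
  qed
qed

lemma dual_vector_return:
  assumes "finite_game G"
  shows "dual_vector G return_pmf return_pmf"
  using assms by (auto simp: dual_vector_def deviation_plan_def mixed_def mutil1_return mutil2_return)

lemma dual_vector_bind:
  assumes "finite_game G" "finite A" "set_pmf p \<subseteq> A"
    and dv: "\<And>x. x \<in> A \<Longrightarrow> dual_vector G (\<beta>1 x) (\<beta>2 x)"
  shows "dual_vector G (\<lambda>c. bind_pmf p (\<lambda>x. \<beta>1 x c)) (\<lambda>d. bind_pmf p (\<lambda>x. \<beta>2 x d))"
  unfolding dual_vector_def
proof (intro conjI ballI)
  show "deviation_plan (strats1 G) (\<lambda>c. bind_pmf p (\<lambda>x. \<beta>1 x c))"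
    "deviation_plan (strats2 G) (\<lambda>d. bind_pmf p (\<lambda>x. \<beta>2 x d))"
    using dv assms(3) unfolding dual_vector_def deviation_plan_def mixed_def by (simp_all, blast+)
next
  fix c d assume cd: "c \<in> strats1 G" "d \<in> strats2 G"
  have one: "(\<Sum>x\<in>A. pmf p x) = 1"
    using assms by (intro sum_pmf_eq_1)
  have "0 \<le> (\<Sum>x\<in>A. pmf p x * ((mutil1 G (\<beta>1 x c) (return_pmf d) - util1 G c d) +
      (mutil2 G (return_pmf c) (\<beta>2 x d) - util2 G c d)))"
    using dv cd by (intro sum_nonneg mult_nonneg_nonneg) (auto simp: dual_vector_def)
  also have "\<dots> = (\<Sum>x\<in>A. pmf p x * mutil1 G (\<beta>1 x c) (return_pmf d)) - (\<Sum>x\<in>A. pmf p x) * util1 G c d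
      + ((\<Sum>x\<in>A. pmf p x * mutil2 G (return_pmf c) (\<beta>2 x d)) - (\<Sum>x\<in>A. pmf p x) * util2 G c d)"
    unfolding sum_distrib_right by (simp add: algebra_simps sum.distrib sum_subtractf)
  also have "\<dots> = (mutil1 G (bind_pmf p (\<lambda>x. \<beta>1 x c)) (return_pmf d) - util1 G c d) +
      (mutil2 G (return_pmf c) (bind_pmf p (\<lambda>x. \<beta>2 x d)) - util2 G c d)"
    by (simp add: one mutil1_bind_left[OF assms(2,3)] mutil2_bind_right[OF assms(2,3)])
  finally show "0 \<le> \<dots>" .
qed

text \<open>For each of the finitely many deviations, choose a dual vector that uses it if there is one. The dual inequalities
are affine in the deviation plans, so the uniform mixture of the choices is again a dual vector, and it uses every
deviation that any dual vector uses.\<close>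

lemma ex_full_dual_vector:
  assumes "finite_game G"
  shows "\<exists>\<alpha>1 \<alpha>2. full_dual_vector G \<alpha>1 \<alpha>2"
proof -
  define T where "T = (strats1 G \<times> strats1 G) <+> (strats2 G \<times> strats2 G)"
  define positive where "positive x \<beta> \<longleftrightarrow>
      (case x of Inl (c, d) \<Rightarrow> pmf (fst \<beta> c) d > 0 | Inr (c, d) \<Rightarrow> pmf (snd \<beta> c) d > 0)"
    for x :: "'a \<times> 'a + 'b \<times> 'b" and \<beta> :: "('a \<Rightarrow> 'a pmf) \<times> ('b \<Rightarrow> 'b pmf)"
  have "\<forall>x. \<exists>\<beta>. dual_vector G (fst \<beta>) (snd \<beta>) \<and>
      ((\<exists>\<gamma>. dual_vector G (fst \<gamma>) (snd \<gamma>) \<and> positive x \<gamma>) \<longrightarrow> positive x \<beta>)"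
    using dual_vector_return[OF assms] by (metis fst_conv snd_conv)
  then obtain w where w: "\<And>x. dual_vector G (fst (w x)) (snd (w x))"
      "\<And>x \<gamma>. dual_vector G (fst \<gamma>) (snd \<gamma>) \<Longrightarrow> positive x \<gamma> \<Longrightarrow> positive x (w x)"
    by metis
  have T: "finite T" "T \<noteq> {}"
    using assms by (auto simp: T_def finite_game_def)
  let ?p = "pmf_of_set T"
  have set_p: "set_pmf ?p = T"
    using T by simp
  define \<alpha>1 where "\<alpha>1 c = bind_pmf ?p (\<lambda>x. fst (w x) c)" for c
  define \<alpha>2 where "\<alpha>2 c = bind_pmf ?p (\<lambda>x. snd (w x) c)" for c
  have dv: "dual_vector G \<alpha>1 \<alpha>2"
    unfolding \<alpha>1_def \<alpha>2_def using w(1) T set_p by (intro dual_vector_bind[OF assms, of T]) auto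
  have "pmf (\<alpha>1 c) d > 0"
    if "dual_vector G \<beta>1 \<beta>2" "c \<in> strats1 G" "d \<in> strats1 G" "pmf (\<beta>1 c) d > 0" for \<beta>1 \<beta>2 c d
  proof -
    have "positive (Inl (c, d)) (w (Inl (c, d)))"
      using w(2)[of "(\<beta>1, \<beta>2)" "Inl (c, d)"] that by (simp add: positive_def)
    moreover have "Inl (c, d) \<in> T"
      using that by (auto simp: T_def)
    ultimately have "d \<in> set_pmf (\<alpha>1 c)"
      unfolding \<alpha>1_def set_bind_pmf set_p
      by (intro UN_I[of "Inl (c, d)"]) (simp_all add: positive_def set_pmf_iff)
    then show ?thesis by (rule pmf_positive)
  qed
  moreover have "pmf (\<alpha>2 c) d > 0"
    if "dual_vector G \<beta>1 \<beta>2" "c \<in> strats2 G" "d \<in> strats2 G" "pmf (\<beta>2 c) d > 0" for \<beta>1 \<beta>2 c d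
  proof -
    have "positive (Inr (c, d)) (w (Inr (c, d)))"
      using w(2)[of "(\<beta>1, \<beta>2)" "Inr (c, d)"] that by (simp add: positive_def)
    moreover have "Inr (c, d) \<in> T"
      using that by (auto simp: T_def)
    ultimately have "d \<in> set_pmf (\<alpha>2 c)"
      unfolding \<alpha>2_def set_bind_pmf set_p
      by (intro UN_I[of "Inr (c, d)"]) (simp_all add: positive_def set_pmf_iff)
    then show ?thesis by (rule pmf_positive)
  qed
  ultimately show ?thesis
    using dv unfolding full_dual_vector_def by blast
qed

lemma full_dual_vector_same_support:
  assumes "full_dual_vector G \<alpha>1 \<alpha>2" "full_dual_vector G \<beta>1 \<beta>2" "c \<in> strats1 G"
  shows "set_pmf (\<alpha>1 c) = set_pmf (\<beta>1 c)"
proof -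
  have "set_pmf (\<alpha> c) \<subseteq> set_pmf (\<beta> c)"
    if "full_dual_vector G \<alpha> \<alpha>'" "full_dual_vector G \<beta> \<beta>'" for \<alpha> \<alpha>' \<beta> \<beta>'
  proof
    fix d assume d: "d \<in> set_pmf (\<alpha> c)"
    then have "d \<in> strats1 G"
      using that(1) assms(3) unfolding full_dual_vector_def dual_vector_def deviation_plan_def mixed_def
      by blast
    moreover have "pmf (\<alpha> c) d > 0"
      using d by (rule pmf_positive)
    ultimately have "pmf (\<beta> c) d > 0"
      using that assms(3) unfolding full_dual_vector_def by blast
    then show "d \<in> set_pmf (\<beta> c)"
      by (simp add: set_pmf_iff)
  qed
  with assms show ?thesis by blast
qed

lemma full_dual_vector_same_minimal_absorbing:
  assumes "full_dual_vector G \<alpha>1 \<alpha>2" "full_dual_vector G \<beta>1 \<beta>2"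
  shows "minimal_absorbing (strats1 G) \<alpha>1 B \<longleftrightarrow> minimal_absorbing (strats1 G) \<beta>1 B"
proof -
  have "absorbing (strats1 G) \<alpha>1 B = absorbing (strats1 G) \<beta>1 B" for B
    using full_dual_vector_same_support[OF assms] unfolding absorbing_def
    by (intro conj_cong refl ball_cong) auto
  then show ?thesis
    by (simp add: minimal_absorbing_def)
qed

section \<open>Full dual reductions\<close>

lemma reduced_strats_nonempty:
  assumes "finite_game G" "dual_vector G \<alpha>1 \<alpha>2"
  shows "reduced_strats (strats1 G) \<alpha>1 \<noteq> {}" "reduced_strats (strats2 G) \<alpha>2 \<noteq> {}"
proof -
  have "\<exists>B. minimal_absorbing (strats1 G) \<alpha>1 B" "\<exists>B. minimal_absorbing (strats2 G) \<alpha>2 B"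
    using assms by (auto simp: finite_game_def dual_vector_def intro!: ex_minimal_absorbing)
  then show "reduced_strats (strats1 G) \<alpha>1 \<noteq> {}" "reduced_strats (strats2 G) \<alpha>2 \<noteq> {}"
    using assms(1) ex_reduced_strat by (fastforce simp: finite_game_def)+
qed

text \<open>A stationary strategy \<open>\<tau>\<close> of the second player for \<open>\<alpha>2\<close> has a support that is minimal absorbing for
\<open>\<beta>2\<close> as well, so \<open>\<tau>\<close> serves as the common equilibrium partner of \<open>\<sigma>\<close> and \<open>\<sigma>'\<close>, although \<open>\<sigma>'\<close> belongs to the other dual vector.
With \<open>\<beta> = \<alpha>\<close> this includes the uniqueness of the stationary distribution on a minimal absorbing set.\<close>

lemma reduced_strats_unique:
  assumes "finite_game G" "equal_supports G"
    and "full_dual_vector G \<alpha>1 \<alpha>2" "full_dual_vector G \<beta>1 \<beta>2"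
    and "\<sigma> \<in> reduced_strats (strats1 G) \<alpha>1" "\<sigma>' \<in> reduced_strats (strats1 G) \<beta>1"
    and "set_pmf \<sigma>' = set_pmf \<sigma>"
  shows "\<sigma> = \<sigma>'"
proof -
  have dv: "dual_vector G \<alpha>1 \<alpha>2" "dual_vector G \<beta>1 \<beta>2"
    using assms(3,4) by (simp_all add: full_dual_vector_def)
  obtain \<tau> where \<tau>: "\<tau> \<in> reduced_strats (strats2 G) \<alpha>2"
    using reduced_strats_nonempty(2)[OF assms(1) dv(1)] by blast
  have m2: "minimal_absorbing (strats2 G) \<alpha>2 (set_pmf \<tau>)"
    using \<tau> by (rule reduced_strats_minimal_absorbing)
  then have m2': "minimal_absorbing (strats2 G) \<beta>2 (set_pmf \<tau>)"
    using full_dual_vector_same_minimal_absorbing[OF assms(3,4)[THEN full_dual_vector_swap]] by simp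
  show ?thesis
  proof (rule indifferent1_unique[OF assms(1,2)])
    show "indifferent1 G (set_pmf \<sigma>) \<tau>"
      using reduced_strats_minimal_absorbing[OF assms(5)] \<tau>
      by (rule minimal_absorbing_indifferent[OF assms(1) dv(1)])
    show "indifferent1 (swap_game G) (set_pmf \<tau>) \<sigma>"
      using minimal_absorbing_indifferent[of "swap_game G" \<alpha>2 \<alpha>1] assms(1,5) dv m2 by simp
    show "indifferent1 (swap_game G) (set_pmf \<tau>) \<sigma>'"
      using minimal_absorbing_indifferent[of "swap_game G" \<beta>2 \<beta>1] assms(1,6) dv m2' by simp
  qed (use assms(5,7) \<tau> in \<open>auto simp: reduced_strats_def mixed_def\<close>)
qed

lemma reduced_strats_subset:
  assumes "finite_game G" "equal_supports G"
    and "full_dual_vector G \<alpha>1 \<alpha>2" "full_dual_vector G \<beta>1 \<beta>2"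
  shows "reduced_strats (strats1 G) \<alpha>1 \<subseteq> reduced_strats (strats1 G) \<beta>1"
proof
  fix \<sigma> assume \<sigma>: "\<sigma> \<in> reduced_strats (strats1 G) \<alpha>1"
  have "minimal_absorbing (strats1 G) \<beta>1 (set_pmf \<sigma>)"
    using reduced_strats_minimal_absorbing[OF \<sigma>] full_dual_vector_same_minimal_absorbing[OF assms(3,4)] by simp
  then obtain \<sigma>' where "\<sigma>' \<in> reduced_strats (strats1 G) \<beta>1" "set_pmf \<sigma>' = set_pmf \<sigma>"
    using ex_reduced_strat assms(1) by (metis finite_game_def)
  then show "\<sigma> \<in> reduced_strats (strats1 G) \<beta>1"
    using reduced_strats_unique[OF assms \<sigma>] by blast
qed

lemma ex1_full_dual_reduction:
  assumes "finite_game G" "equal_supports G"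
  shows "\<exists>!H. full_dual_reduction G H"
proof -
  obtain \<alpha>1 \<alpha>2 where \<alpha>: "full_dual_vector G \<alpha>1 \<alpha>2"
    using ex_full_dual_vector[OF assms(1)] by blast
  have "dual_reduction G \<beta>1 \<beta>2 = dual_reduction G \<alpha>1 \<alpha>2" if "full_dual_vector G \<beta>1 \<beta>2" for \<beta>1 \<beta>2
  proof -
    have "reduced_strats (strats1 G) \<beta>1 = reduced_strats (strats1 G) \<alpha>1"
      using reduced_strats_subset[OF assms] \<alpha> that by (meson equalityI)
    moreover have "reduced_strats (strats2 G) \<beta>2 = reduced_strats (strats2 G) \<alpha>2"
      using reduced_strats_subset[of "swap_game G"] assms \<alpha> that
      by (metis equalityI equal_supports_swap finite_game_swap full_dual_vector_swap swap_game_simps(1))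
    ultimately show ?thesis
      by (simp add: dual_reduction_def)
  qed
  with \<alpha> show ?thesis
    unfolding full_dual_reduction_def by metis
qed

lemma reduced_strats_completely_mixed_nash:
  assumes "finite_game G" "dual_vector G \<alpha>1 \<alpha>2"
    and "\<sigma> \<in> reduced_strats (strats1 G) \<alpha>1" "\<tau> \<in> reduced_strats (strats2 G) \<alpha>2"
  shows "completely_mixed_nash (restrict_game G (set_pmf \<sigma>) (set_pmf \<tau>)) \<sigma> \<tau>"
proof -
  have "nash (restrict_game G (set_pmf \<sigma>) (set_pmf \<tau>)) \<sigma> \<tau>"
  proof (rule nash_of_indifferent[OF assms(1)])
    show "indifferent1 G (set_pmf \<sigma>) \<tau>"
      using reduced_strats_minimal_absorbing[OF assms(3)] assms(4)
      by (rule minimal_absorbing_indifferent[OF assms(1,2)])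
    show "indifferent1 (swap_game G) (set_pmf \<tau>) \<sigma>"
      using minimal_absorbing_indifferent[of "swap_game G" \<alpha>2 \<alpha>1] assms
        reduced_strats_minimal_absorbing[OF assms(4)] by simp
  qed (use assms(3,4) in \<open>auto simp: reduced_strats_def mixed_def\<close>)
  then show ?thesis
    by (simp add: completely_mixed_nash_def pmf_positive)
qed

lemma reduced_strats_card_eq:
  assumes "finite_game G" "equal_supports G" "dual_vector G \<alpha>1 \<alpha>2"
    and "\<sigma> \<in> reduced_strats (strats1 G) \<alpha>1" "\<tau> \<in> reduced_strats (strats2 G) \<alpha>2"
  shows "card (set_pmf \<sigma>) = card (set_pmf \<tau>)"
proof -
  have "nash (restrict_game G (set_pmf \<sigma>) (set_pmf \<tau>)) \<sigma> \<tau>"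
    using reduced_strats_completely_mixed_nash[OF assms(1,3-5)] by (simp add: completely_mixed_nash_def)
  moreover have "set_pmf \<sigma> \<subseteq> strats1 G" "set_pmf \<tau> \<subseteq> strats2 G"
    using assms(4,5) by (auto simp: reduced_strats_def mixed_def)
  ultimately show ?thesis
    using equal_supportsD[OF assms(2)] by (simp add: set_pmf_not_empty)
qed

text \<open>Two different stationary strategies of the first player have disjoint supports, and both are in
completely mixed equilibrium with the same \<open>\<tau>\<close>, which \<open>distinct_components\<close> excludes as soon as the common size of the supports is at least 2.\<close>

lemma reduced_strats_singleton:
  assumes "finite_game G" "equal_supports G" "distinct_components G" "full_dual_vector G \<alpha>1 \<alpha>2"
    and "\<sigma> \<in> reduced_strats (strats1 G) \<alpha>1" "\<sigma>' \<in> reduced_strats (strats1 G) \<alpha>1"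
    and "2 \<le> card (set_pmf \<sigma>)"
  shows "\<sigma> = \<sigma>'"
proof (rule ccontr)
  assume neq: "\<sigma> \<noteq> \<sigma>'"
  have dv: "dual_vector G \<alpha>1 \<alpha>2"
    using assms(4) by (simp add: full_dual_vector_def)
  obtain \<tau> where \<tau>: "\<tau> \<in> reduced_strats (strats2 G) \<alpha>2"
    using reduced_strats_nonempty(2)[OF assms(1) dv] by blast
  have "set_pmf \<sigma> \<noteq> set_pmf \<sigma>'"
    using reduced_strats_unique[OF assms(1,2,4,4,5,6)] neq by auto
  then have "set_pmf \<sigma> \<inter> set_pmf \<sigma>' = {}"
    using reduced_strats_minimal_absorbing[OF assms(5)] reduced_strats_minimal_absorbing[OF assms(6)]
    by (intro minimal_absorbing_disjoint)
  moreover have "card (set_pmf \<sigma>) = card (set_pmf \<tau>)" "card (set_pmf \<sigma>') = card (set_pmf \<tau>)"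
    using reduced_strats_card_eq[OF assms(1,2) dv _ \<tau>] assms(5,6) by auto
  moreover have "completely_mixed_nash (restrict_game G (set_pmf \<sigma>) (set_pmf \<tau>)) \<sigma> \<tau>"
    "completely_mixed_nash (restrict_game G (set_pmf \<sigma>') (set_pmf \<tau>)) \<sigma>' \<tau>"
    using reduced_strats_completely_mixed_nash[OF assms(1) dv _ \<tau>] assms(5,6) by auto
  moreover have "set_pmf \<sigma> \<subseteq> strats1 G" "set_pmf \<sigma>' \<subseteq> strats1 G" "set_pmf \<tau> \<subseteq> strats2 G"
    using assms(5,6) \<tau> by (auto simp: reduced_strats_def mixed_def)
  ultimately show False
    using conjunct2[OF iffD1[OF distinct_components_def assms(3)]] assms(7) by metis
qed

section \<open>Embeddings of games\<close>

text \<open>Up to renaming strategies, \<open>H\<close> is the restriction of \<open>G\<close> to the images of \<open>f\<close> and \<open>g\<close>. Since the conditions on \<open>G\<close>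
quantify over all its restrictions, \<open>H\<close> inherits them.\<close>

definition embeds :: "('a, 'b) game \<Rightarrow> ('c, 'd) game \<Rightarrow> ('a \<Rightarrow> 'c) \<Rightarrow> ('b \<Rightarrow> 'd) \<Rightarrow> bool" where
  "embeds H G f g \<longleftrightarrow>
     inj_on f (strats1 H) \<and> f ` strats1 H \<subseteq> strats1 G \<and>
     inj_on g (strats2 H) \<and> g ` strats2 H \<subseteq> strats2 G \<and>
     (\<forall>c\<in>strats1 H. \<forall>d\<in>strats2 H. util1 G (f c) (g d) = util1 H c d \<and> util2 G (f c) (g d) = util2 H c d)"

lemma embeds_swap: "embeds H G f g \<Longrightarrow> embeds (swap_game H) (swap_game G) g f"
  by (auto simp: embeds_def)

lemma mutil1_map:
  assumes "inj_on f B1" "inj_on g B2" "\<sigma> \<in> mixed B1" "\<tau> \<in> mixed B2"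
    and "\<And>c d. c \<in> B1 \<Longrightarrow> d \<in> B2 \<Longrightarrow> util1 G (f c) (g d) = util1 H c d"
  shows "mutil1 (restrict_game G (f ` B1) (g ` B2)) (map_pmf f \<sigma>) (map_pmf g \<tau>) =
         mutil1 (restrict_game H B1 B2) \<sigma> \<tau>"
proof -
  have pm: "pmf (map_pmf h \<rho>) (h x) = pmf \<rho> x" if "inj_on h B" "\<rho> \<in> mixed B" "x \<in> B"
    for h :: "'x \<Rightarrow> 'y" and B \<rho> x
  proof (cases "x \<in> set_pmf \<rho>")
    case True
    then show ?thesis
      using that by (intro pmf_map_inj) (auto simp: mixed_def intro: inj_on_subset)
  next
    case False
    then have "h x \<notin> h ` set_pmf \<rho>"
      using that by (auto simp: mixed_def inj_on_def)
    then show ?thesis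
      using False by (metis set_map_pmf pmf_eq_0_set_pmf)
  qed
  show ?thesis
    unfolding mutil1_def restrict_game_simps sum.reindex[OF assms(1)] sum.reindex[OF assms(2)] o_def
    using assms(5) pm[OF assms(1,3)] pm[OF assms(2,4)] by (intro sum.cong refl) simp
qed

lemma map_pmf_mixed: "\<sigma> \<in> mixed B \<Longrightarrow> map_pmf f \<sigma> \<in> mixed (f ` B)"
  by (auto simp: mixed_def)

lemma ex_map_pmf_mixed:
  assumes "\<sigma>' \<in> mixed (f ` B)"
  obtains \<sigma> where "\<sigma> \<in> mixed B" "\<sigma>' = map_pmf f \<sigma>"
proof
  show "map_pmf (inv_into B f) \<sigma>' \<in> mixed B"
    using assms by (auto simp: mixed_def intro!: inv_into_into)
  show "\<sigma>' = map_pmf f (map_pmf (inv_into B f) \<sigma>')"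
    unfolding pmf.map_comp using assms
    by (subst map_pmf_idI) (auto simp: mixed_def f_inv_into_f)
qed

lemma nash_embeds:
  assumes "embeds H G f g" "B1 \<subseteq> strats1 H" "B2 \<subseteq> strats2 H"
    and "nash (restrict_game H B1 B2) \<sigma> \<tau>"
  shows "nash (restrict_game G (f ` B1) (g ` B2)) (map_pmf f \<sigma>) (map_pmf g \<tau>)"
proof -
  have inj: "inj_on f B1" "inj_on g B2"
    using assms(1-3) by (auto simp: embeds_def intro: inj_on_subset)
  have u: "\<And>c d. c \<in> B1 \<Longrightarrow> d \<in> B2 \<Longrightarrow> util1 G (f c) (g d) = util1 H c d"
      "\<And>d c. d \<in> B2 \<Longrightarrow> c \<in> B1 \<Longrightarrow> util1 (swap_game G) (g d) (f c) = util1 (swap_game H) d c"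
    using assms(1-3) unfolding embeds_def swap_game_simps by blast+
  have mx: "\<sigma> \<in> mixed B1" "\<tau> \<in> mixed B2"
    using assms(4) by (simp_all add: nash_def)
  note eq1 = mutil1_map[OF inj _ _ u(1)]
  note eq2 = mutil1_map[OF inj(2,1) _ _ u(2), unfolded restrict_swap mutil_swap]
  show ?thesis
    unfolding nash_def restrict_game_simps
  proof (intro conjI ballI)
    fix \<sigma>' assume "\<sigma>' \<in> mixed (f ` B1)"
    then obtain \<rho> where "\<rho> \<in> mixed B1" "\<sigma>' = map_pmf f \<rho>"
      by (rule ex_map_pmf_mixed)
    then show "mutil1 (restrict_game G (f ` B1) (g ` B2)) \<sigma>' (map_pmf g \<tau>)
        \<le> mutil1 (restrict_game G (f ` B1) (g ` B2)) (map_pmf f \<sigma>) (map_pmf g \<tau>)"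
      using assms(4) mx by (simp add: eq1 nash_def)
  next
    fix \<tau>' assume "\<tau>' \<in> mixed (g ` B2)"
    then obtain \<rho> where "\<rho> \<in> mixed B2" "\<tau>' = map_pmf g \<rho>"
      by (rule ex_map_pmf_mixed)
    then show "mutil2 (restrict_game G (f ` B1) (g ` B2)) (map_pmf f \<sigma>) \<tau>'
        \<le> mutil2 (restrict_game G (f ` B1) (g ` B2)) (map_pmf f \<sigma>) (map_pmf g \<tau>)"
      using assms(4) mx by (simp add: eq2 nash_def)
  qed (use mx in \<open>auto intro: map_pmf_mixed\<close>)
qed

lemma completely_mixed_nash_support:
  "completely_mixed_nash G \<sigma> \<tau> \<longleftrightarrow>
     nash G \<sigma> \<tau> \<and> set_pmf \<sigma> = strats1 G \<and> set_pmf \<tau> = strats2 G"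
proof -
  have pos: "(\<forall>c\<in>B. pmf \<rho> c > 0) \<longleftrightarrow> B \<subseteq> set_pmf \<rho>" for B :: "'z set" and \<rho>
    by (auto simp: pmf_positive_iff)
  show ?thesis
    unfolding completely_mixed_nash_def pos by (auto simp: nash_def mixed_def)
qed

lemma completely_mixed_nash_embeds:
  assumes "embeds H G f g" "B1 \<subseteq> strats1 H" "B2 \<subseteq> strats2 H"
    and "completely_mixed_nash (restrict_game H B1 B2) \<sigma> \<tau>"
  shows "completely_mixed_nash (restrict_game G (f ` B1) (g ` B2)) (map_pmf f \<sigma>) (map_pmf g \<tau>)"
  using nash_embeds[OF assms(1-3)] assms(4) by (simp add: completely_mixed_nash_support)

lemma equal_supports_embeds:
  assumes "embeds H G f g" "equal_supports G"
  shows "equal_supports H"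
  unfolding equal_supports_def
proof (intro allI impI, elim conjE)
  fix B1 B2 \<sigma> \<tau>
  assume B: "B1 \<noteq> {}" "B1 \<subseteq> strats1 H" "B2 \<noteq> {}" "B2 \<subseteq> strats2 H"
    and n: "nash (restrict_game H B1 B2) \<sigma> \<tau>"
  have "f ` B1 \<subseteq> strats1 G" "g ` B2 \<subseteq> strats2 G"
    using assms(1) B unfolding embeds_def by blast+
  then have "card (set_pmf (map_pmf f \<sigma>)) = card (set_pmf (map_pmf g \<tau>))"
    using equal_supportsD[OF assms(2) nash_embeds[OF assms(1) B(2,4) n]] B by simp
  moreover have "inj_on f (set_pmf \<sigma>)" "inj_on g (set_pmf \<tau>)"
    using assms(1) B n unfolding embeds_def nash_def mixed_def restrict_game_simps mem_Collect_eq
    by (meson inj_on_subset)+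
  ultimately show "card (set_pmf \<sigma>) = card (set_pmf \<tau>)"
    by (simp add: card_image)
qed

lemma distinct_components_embeds:
  assumes "embeds H G f g" "distinct_components G"
  shows "distinct_components H"
proof -
  have half: "\<sigma> \<noteq> \<sigma>'"
    if "embeds H G f g" "distinct_components G"
      "B1 \<subseteq> strats1 H \<and> B2 \<subseteq> strats2 H \<and> B2' \<subseteq> strats2 H \<and>
       card B1 = card B2 \<and> card B2 = card B2' \<and> 2 \<le> card B1 \<and> B2 \<inter> B2' = {} \<and>
       completely_mixed_nash (restrict_game H B1 B2) \<sigma> \<tau> \<and>
       completely_mixed_nash (restrict_game H B1 B2') \<sigma>' \<tau>'"
    for H :: "('x, 'y) game" and G :: "('z, 'w) game" and f g B1 B2 B2' \<sigma> \<tau> \<sigma>' \<tau>'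
  proof -
    have inj: "inj_on f B1" "inj_on g (B2 \<union> B2')" "inj_on g B2" "inj_on g B2'"
      using that(1,3) by (auto simp: embeds_def intro: inj_on_subset)
    have sub: "f ` B1 \<subseteq> strats1 G" "g ` B2 \<subseteq> strats2 G" "g ` B2' \<subseteq> strats2 G"
      using that(1,3) unfolding embeds_def by blast+
    have "g ` B2 \<inter> g ` B2' = {}"
      using inj_on_image_Int[OF inj(2), of B2 B2'] that(3) by simp
    moreover have "completely_mixed_nash (restrict_game G (f ` B1) (g ` B2)) (map_pmf f \<sigma>) (map_pmf g \<tau>)"
      "completely_mixed_nash (restrict_game G (f ` B1) (g ` B2')) (map_pmf f \<sigma>') (map_pmf g \<tau>')"
      using completely_mixed_nash_embeds[OF that(1)] that(3) by blast+
    moreover have "card (f ` B1) = card (g ` B2)" "card (g ` B2) = card (g ` B2')" "2 \<le> card (f ` B1)"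
      using inj that(3) by (simp_all add: card_image)
    ultimately have "map_pmf f \<sigma> \<noteq> map_pmf f \<sigma>'"
      using sub by (intro conjunct1[OF iffD1[OF distinct_components_def that(2)], rule_format]) (intro conjI)
    then show ?thesis by blast
  qed
  show ?thesis
    unfolding distinct_components_def
    using half[OF assms]
      half[OF embeds_swap[OF assms(1)] distinct_components_swap[OF assms(2)],
        unfolded restrict_swap completely_mixed_nash_swap swap_game_simps]
    by blast
qed

section \<open>Iterating the reduction\<close>

lemma finite_reduced_strats:
  assumes "finite_game G" "equal_supports G" "full_dual_vector G \<alpha>1 \<alpha>2"
  shows "finite (reduced_strats (strats1 G) \<alpha>1)"
proof (rule inj_on_finite)
  show "inj_on set_pmf (reduced_strats (strats1 G) \<alpha>1)"
    using reduced_strats_unique[OF assms(1,2,3,3)] by (auto intro!: inj_onI)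
  show "set_pmf ` reduced_strats (strats1 G) \<alpha>1 \<subseteq> Pow (strats1 G)"
    by (auto simp: reduced_strats_def mixed_def)
  show "finite (Pow (strats1 G))"
    using assms(1) by (simp add: finite_game_def)
qed

lemma one_by_one_game:
  assumes "strats1 H = {\<sigma>}" "strats2 H = {\<tau>}"
  shows "equal_supports H" "distinct_components H"
proof -
  have *: "card (set_pmf \<rho>) = 1" if "set_pmf \<rho> \<subseteq> {x}" for \<rho> :: "'z pmf" and x
    using that set_pmf_not_empty[of \<rho>] by (simp add: subset_singleton_iff)
  show "equal_supports H"
    unfolding equal_supports_def nash_def mixed_def restrict_game_simps assms
    using * by (metis (mono_tags, lifting) mem_Collect_eq subset_trans)
  have no_pair: False if "B \<subseteq> {x}" "2 \<le> card B" for B :: "'z set" and x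
    using card_mono[OF _ that(1)] that(2) by simp
  show "distinct_components H"
    unfolding distinct_components_def assms
    by (intro conjI allI impI; elim conjE; drule (1) no_pair; erule FalseE)
qed

text \<open>The invariant of the iteration.\<close>

definition generic_game :: "('a, 'b) game \<Rightarrow> bool" where
  "generic_game G \<longleftrightarrow> finite_game G \<and> equal_supports G \<and> distinct_components G"

lemma generic_game_full_dual_reduction:
  assumes "generic_game G" "full_dual_reduction G H"
  shows "generic_game H"
proof -
  from assms(2) obtain \<alpha>1 \<alpha>2 where \<alpha>: "full_dual_vector G \<alpha>1 \<alpha>2" and H: "H = dual_reduction G \<alpha>1 \<alpha>2"
    by (auto simp: full_dual_reduction_def)
  have G: "finite_game G" "equal_supports G" "distinct_components G"
    using assms(1) by (auto simp: generic_game_def)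
  have dv: "dual_vector G \<alpha>1 \<alpha>2"
    using \<alpha> by (simp add: full_dual_vector_def)
  define R1 where "R1 = reduced_strats (strats1 G) \<alpha>1"
  define R2 where "R2 = reduced_strats (strats2 G) \<alpha>2"
  have H_simps: "strats1 H = R1" "strats2 H = R2" "util1 H = mutil1 G" "util2 H = mutil2 G"
    by (simp_all add: H dual_reduction_def R1_def R2_def)
  have ne: "R1 \<noteq> {}" "R2 \<noteq> {}"
    using reduced_strats_nonempty[OF G(1) dv] by (simp_all add: R1_def R2_def)
  have fin: "finite R1" "finite R2"
    using finite_reduced_strats[OF G(1,2) \<alpha>] finite_reduced_strats[of "swap_game G" \<alpha>2 \<alpha>1]
      G equal_supports_swap[OF G(2)] full_dual_vector_swap[OF \<alpha>] by (simp_all add: R1_def R2_def)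
  have card: "card (set_pmf \<sigma>) = card (set_pmf \<tau>)" if "\<sigma> \<in> R1" "\<tau> \<in> R2" for \<sigma> \<tau>
    using reduced_strats_card_eq[OF G(1,2) dv] that by (simp add: R1_def R2_def)
  have sub: "set_pmf \<sigma> \<subseteq> strats1 G" "set_pmf \<tau> \<subseteq> strats2 G" if "\<sigma> \<in> R1" "\<tau> \<in> R2" for \<sigma> \<tau>
    using that by (auto simp: R1_def R2_def reduced_strats_def mixed_def)
  obtain \<sigma>0 \<tau>0 where 0: "\<sigma>0 \<in> R1" "\<tau>0 \<in> R2"
    using ne by blast
  have "equal_supports H \<and> distinct_components H"
  proof (cases "card (set_pmf \<sigma>0) = 1")
    case True
    \<comment> \<open>All strategies left are pure, so taking the point of the support embeds the reduction into \<open>G\<close>.\<close>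
    have "is_singleton (set_pmf \<sigma>)" if "\<sigma> \<in> R1" for \<sigma>
      using card[OF that 0(2)] card[OF 0] True by (simp add: is_singleton_altdef)
    then have pure1: "\<sigma> = return_pmf (the_elem (set_pmf \<sigma>))" if "\<sigma> \<in> R1" for \<sigma>
      using that by (metis is_singleton_the_elem set_pmf_subset_singleton subset_refl)
    have "is_singleton (set_pmf \<tau>)" if "\<tau> \<in> R2" for \<tau>
      using card[OF 0(1) that] True by (simp add: is_singleton_altdef)
    then have pure2: "\<tau> = return_pmf (the_elem (set_pmf \<tau>))" if "\<tau> \<in> R2" for \<tau>
      using that by (metis is_singleton_the_elem set_pmf_subset_singleton subset_refl)
    let ?h1 = "\<lambda>\<sigma> :: 'a pmf. the_elem (set_pmf \<sigma>)" and ?h2 = "\<lambda>\<tau> :: 'b pmf. the_elem (set_pmf \<tau>)"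
    have mem: "?h1 \<sigma> \<in> strats1 G" "?h2 \<tau> \<in> strats2 G" if "\<sigma> \<in> R1" "\<tau> \<in> R2" for \<sigma> \<tau>
      using sub[OF that] pure1[OF that(1)] pure2[OF that(2)]
      by (metis insert_subset set_return_pmf)+
    have "embeds H G ?h1 ?h2"
      unfolding embeds_def H_simps
    proof (intro conjI ballI)
      show "inj_on ?h1 R1" "inj_on ?h2 R2"
        by (auto intro!: inj_on_inverseI[where g = return_pmf] simp flip: pure1 pure2)
      show "?h1 ` R1 \<subseteq> strats1 G" "?h2 ` R2 \<subseteq> strats2 G"
        using mem 0 by blast+
      fix \<sigma> \<tau> assume st: "\<sigma> \<in> R1" "\<tau> \<in> R2"
      show "util1 G (?h1 \<sigma>) (?h2 \<tau>) = mutil1 G \<sigma> \<tau>" "util2 G (?h1 \<sigma>) (?h2 \<tau>) = mutil2 G \<sigma> \<tau>"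
        using mutil1_return[OF G(1) mem[OF st]] mutil2_return[OF G(1) mem[OF st]]
        by (simp_all flip: pure1[OF st(1)] pure2[OF st(2)])
    qed
    then show ?thesis
      using equal_supports_embeds distinct_components_embeds G by blast
  next
    case False
    have "card (set_pmf \<sigma>0) \<noteq> 0"
      using sub[OF 0] G(1) by (auto simp: finite_game_def set_pmf_not_empty finite_subset)
    with False have "2 \<le> card (set_pmf \<sigma>0)" "2 \<le> card (set_pmf \<tau>0)"
      using card[OF 0] by auto
    then have "\<sigma> = \<sigma>0" "\<tau> = \<tau>0" if "\<sigma> \<in> R1" "\<tau> \<in> R2" for \<sigma> \<tau>
      using reduced_strats_singleton[OF G \<alpha>, of \<sigma>0 \<sigma>]
        reduced_strats_singleton[of "swap_game G" \<alpha>2 \<alpha>1 \<tau>0 \<tau>] that 0 G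
        equal_supports_swap[OF G(2)] distinct_components_swap[OF G(3)] full_dual_vector_swap[OF \<alpha>]
      by (simp_all add: R1_def R2_def)
    then have "strats1 H = {\<sigma>0}" "strats2 H = {\<tau>0}"
      using 0 unfolding H_simps by blast+
    then show ?thesis
      using one_by_one_game[of H \<sigma>0 \<tau>0] by simp
  qed
  with fin ne show ?thesis
    by (simp add: generic_game_def finite_game_def H_simps)
qed

lemma generic_game_mix_game:
  assumes "generic_game H"
  shows "generic_game (mix_game H)"
proof -
  have "embeds (mix_game H) H un_Mix un_Mix"
    by (auto simp: embeds_def mix_game_def inj_on_def)
  then have "equal_supports (mix_game H)" "distinct_components (mix_game H)"
    using assms equal_supports_embeds distinct_components_embeds unfolding generic_game_def by blast+
  then show ?thesis
    using assms by (simp add: generic_game_def finite_game_def mix_game_def)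
qed

lemma generic_game_base_game:
  assumes "generic_game G"
  shows "generic_game (base_game G)"
proof -
  have "embeds (base_game G) G un_Base un_Base"
    by (auto simp: embeds_def base_game_def inj_on_def)
  then have "equal_supports (base_game G)" "distinct_components (base_game G)"
    using assms equal_supports_embeds distinct_components_embeds unfolding generic_game_def by blast+
  then show ?thesis
    using assms by (simp add: generic_game_def finite_game_def base_game_def)
qed

theorem theorem27:
  fixes G :: "('a, 'b) game"
  assumes "finite_game G"
    and "equal_supports G"
    and "distinct_components G"
  shows "\<exists>!\<Gamma>. iterative_full_dual_reductions G \<Gamma>"
proof -
  have gen: "generic_game (base_game G)"
    using assms by (intro generic_game_base_game) (simp add: generic_game_def)
  have ex1: "\<exists>!H. full_dual_reduction K H" if "generic_game K" for K :: "('a strat, 'b strat) game"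
    using that by (intro ex1_full_dual_reduction) (simp_all add: generic_game_def)
  have step: "generic_game (mix_game H)" if "generic_game K" "full_dual_reduction K H"
    for K :: "('a strat, 'b strat) game" and H
    using generic_game_full_dual_reduction[OF that] by (rule generic_game_mix_game)
  have gen_all: "generic_game (\<Gamma> k)" if "iterative_full_dual_reductions G \<Gamma>" for \<Gamma> k
    by (induction k) (use that gen step in \<open>auto simp: iterative_full_dual_reductions_def\<close>, metis step)
  define next_game where
    "next_game K = mix_game (THE H. full_dual_reduction K H)" for K :: "('a strat, 'b strat) game"
  define \<Delta> where "\<Delta> k = (next_game ^^ k) (base_game G)" for k
  have red: "full_dual_reduction K (THE H. full_dual_reduction K H)"
    if "generic_game K" for K :: "('a strat, 'b strat) game"
    using ex1[OF that] by (rule theI')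
  have gen_\<Delta>: "generic_game (\<Delta> k)" for k
    by (induction k) (auto simp: \<Delta>_def next_game_def gen intro: step red)
  have "iterative_full_dual_reductions G \<Delta>"
    unfolding iterative_full_dual_reductions_def
    using red[OF gen_\<Delta>] by (auto simp: \<Delta>_def next_game_def)
  moreover have "\<Gamma> = \<Delta>" if \<Gamma>: "iterative_full_dual_reductions G \<Gamma>" for \<Gamma>
  proof
    fix k show "\<Gamma> k = \<Delta> k"
    proof (induction k)
      case 0
      show ?case using \<Gamma> by (simp add: iterative_full_dual_reductions_def \<Delta>_def)
    next
      case (Suc k)
      obtain H where H: "full_dual_reduction (\<Gamma> k) H" "\<Gamma> (Suc k) = mix_game H"
        using \<Gamma> unfolding iterative_full_dual_reductions_def by blast
      have "(THE H. full_dual_reduction (\<Gamma> k) H) = H"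
        using ex1[OF gen_all[OF \<Gamma>]] H(1) by (rule the1_equality)
      then show ?case
        using H(2) Suc.IH by (simp add: \<Delta>_def next_game_def)
    qed
  qed
  ultimately show ?thesis by blast
qed

end
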